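(* Let $s>1$ be a real number. Then, as $n\to\infty$ over positive integers, \[ \frac{1}{n^s} \sum_{x=1}^{n-1} \Big[\Big\{\frac{n}{x}\Big\} - \Big\{\frac{n}{x+1}\Big\}\Big] x^s = \frac{1}{s-1} + 1 - \zeta(s) + O\Big(\frac{1}{\sqrt{n}}\Big), \] where $\zeta$ is the Riemann zeta function and the implied constant may depend on $s$.
   Context: For a real number $y$, $[y]$ denotes the floor of $y$ and $\{y\} = y - [y]$ its fractional part; in the summand, the outer square brackets are ordinary parentheses enclosing the difference of fractional parts. $\zeta(s)=\sum_{x\ge1} x^{-s}$ for $s>1$. *)

theory Defs
  imports Complex_Main "HOL-Library.Landau_Symbols"
begin

text \<open>The Riemann zeta function on the half-line \<open>s > 1\<close>, where the series converges;
  for \<open>s \<le> 1\<close> the value is unspecified (it is not the analytic continuation).\<close>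

definition zeta :: "real \<Rightarrow> real" where
  "zeta s = (\<Sum>k. real (Suc k) powr (- s))"

end

theory Submission
  imports Defs "HOL-Analysis.Summation_Tests"
begin

text \<open>Write \<open>w x = x powr s - (x - 1) powr s\<close>. Summation by parts turns the sum into
  \<open>\<Sum>x\<le>n. frac (n / x) * w x\<close>. Let \<open>K\<close> be about \<open>sqrt n\<close> and \<open>X = n div K\<close>. The terms with \<open>x \<le> X\<close>
  contribute at most \<open>X powr s\<close>. For \<open>x > X\<close> split \<open>frac (n / x) = n / x - n div x\<close>: the first part is
  close to an integral of \<open>s * t powr (s - 2)\<close>, and the second equals
  \<open>\<Sum>k\<le>K. (n div k) powr s - X powr s\<close> by the hyperbola method, which is close to a partial sum of
  \<open>zeta s\<close>. After division by \<open>n powr s\<close> each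
  of these has an error of order \<open>K powr (1 - s)\<close>, too large for \<open>s < 2\<close>,
  but these errors cancel.\<close>

section \<open>Mean value estimates for increments of real powers\<close>

lemma powr_diff_le:
  fixes a b s :: real
  assumes "s \<ge> 1" "0 < b" "b \<le> a"
  shows "a powr s - b powr s \<le> s * (a - b) * a powr (s - 1)"
proof (cases "b = a")
  case False
  with assms have "b < a" by simp
  have "\<exists>z. z > b \<and> z < a \<and> a powr s - b powr s = (a - b) * (s * z powr (s - 1))"
    using assms by (intro MVT2 \<open>b < a\<close>) (auto intro!: derivative_eq_intros simp: powr_diff)
  then obtain z where z: "z > b" "z < a" "a powr s - b powr s = (a - b) * (s * z powr (s - 1))"
    by blast
  have "z powr (s - 1) \<le> a powr (s - 1)"
    using z assms by (intro powr_mono2) auto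
  then have "((a - b) * s) * z powr (s - 1) \<le> ((a - b) * s) * a powr (s - 1)"
    using assms by (intro mult_left_mono) auto
  then show ?thesis using z(3) by (simp add: mult_ac)
qed auto

text \<open>Cauchy's mean value theorem for \<open>t powr s\<close> against \<open>t powr (s - 1)\<close> turns the quotient of the
  two increments into a point of the interval, which lies between its end points.\<close>

lemma powr_increment_quotient_bounds:
  fixes a b s :: real
  assumes "s > 1" "0 < b" "b < a"
  defines "w \<equiv> a powr s - b powr s"
    and "d \<equiv> s / (s - 1) * (a powr (s - 1) - b powr (s - 1))"
  shows "w / a \<le> d" "d \<le> w / b"
proof -
  have diff: "(\<lambda>t. t powr r) differentiable (at x)" if "b < x" for r x
    unfolding real_differentiable_def using \<open>0 < b\<close> that has_real_derivative_powr[of x r]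
    by (meson less_trans)
  have "\<exists>g'c f'c c. DERIV (\<lambda>t. t powr (s - 1)) c :> g'c \<and> DERIV (\<lambda>t. t powr s) c :> f'c \<and>
          b < c \<and> c < a \<and> (a powr s - b powr s) * g'c = (a powr (s - 1) - b powr (s - 1)) * f'c"
    using assms by (intro GMVT) (auto intro!: continuous_intros diff)
  then obtain g f c where
      g: "((\<lambda>t. t powr (s - 1)) has_real_derivative g) (at c)" and
      f: "((\<lambda>t. t powr s) has_real_derivative f) (at c)" and c: "b < c" "c < a"
      and eq: "w * g = (a powr (s - 1) - b powr (s - 1)) * f"
    unfolding w_def by blast
  have "c > 0" using c assms by simp
  have "g = (s - 1) * c powr (s - 1 - 1)"
    using g has_real_derivative_powr[OF \<open>c > 0\<close>, of "s - 1"] by (rule DERIV_unique)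
  moreover have "f = s * c powr (s - 1)"
    using f has_real_derivative_powr[OF \<open>c > 0\<close>, of s] by (rule DERIV_unique)
  moreover have "c powr (s - 1) = c * c powr (s - 1 - 1)"
    using \<open>c > 0\<close> by (simp add: powr_mult_base)
  ultimately have "w * (s - 1) = (a powr (s - 1) - b powr (s - 1)) * s * c"
    using eq \<open>c > 0\<close> by simp
  then have "d = w / c"
    using assms(1) \<open>c > 0\<close> by (simp add: d_def field_simps)
  moreover have "w \<ge> 0"
    using assms by (simp add: w_def powr_mono2)
  ultimately show "w / a \<le> d" "d \<le> w / b"
    using c \<open>c > 0\<close> assms by (auto intro!: divide_left_mono)
qed

text \<open>The mean value theorem together with the decrease of \<open>z powr (- s)\<close>. With
  \<open>a - b = 1\<close> this is the integral test, comparing a term of the zeta series with an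
  increment of the antiderivative.\<close>

lemma powr_minus_increment_bounds:
  fixes a b s :: real
  assumes "s > 1" "0 < b" "b < a"
  shows "(s - 1) * (a - b) * a powr (- s) \<le> b powr (1 - s) - a powr (1 - s)"
    and "b powr (1 - s) - a powr (1 - s) \<le> (s - 1) * (a - b) * b powr (- s)"
proof -
  have "\<exists>z. z > b \<and> z < a \<and>
      a powr (1 - s) - b powr (1 - s) = (a - b) * ((1 - s) * z powr (1 - s - 1))"
    using assms
    by (intro MVT2 assms) (rule has_real_derivative_powr, simp)
  then obtain z where z: "z > b" "z < a"
      "b powr (1 - s) - a powr (1 - s) = (s - 1) * (a - b) * z powr (- s)"
    by (auto simp: algebra_simps)
  have "a powr (- s) \<le> z powr (- s)" "z powr (- s) \<le> b powr (- s)"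
    using z assms by (auto intro!: powr_mono2')
  moreover have "(s - 1) * (a - b) \<ge> 0"
    using assms by simp
  ultimately show "(s - 1) * (a - b) * a powr (- s) \<le> b powr (1 - s) - a powr (1 - s)"
      "b powr (1 - s) - a powr (1 - s) \<le> (s - 1) * (a - b) * b powr (- s)"
    unfolding z(3) by (auto intro: mult_left_mono)
qed

section \<open>Telescoping sums and the tail of the zeta series\<close>

lemma sum_greaterThanAtMost_telescope:
  fixes f :: "nat \<Rightarrow> 'a :: ab_group_add"
  assumes "m \<le> n"
  shows "(\<Sum>x\<in>{m<..n}. f x - f (x - 1)) = f n - f m"
  using assms
proof (induction n rule: dec_induct)
  case (step n)
  then have "{m<..Suc n} = insert (Suc n) {m<..n}" by auto
  with step.IH show ?case by simp
qed simp

text \<open>Termwise comparison of the tail with the integral of \<open>t powr (- s)\<close>. The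
  term \<open>K powr (1 - s) / (s - 1)\<close> is kept explicit because it has to cancel against
  other terms later; only \<open>K powr (- s)\<close> is treated as error.\<close>

lemma zeta_partial_sum_bounds:
  fixes s :: real and K :: nat
  assumes "s > 1" "K > 0"
  defines "Z \<equiv> (\<Sum>k=1..K. real k powr (- s)) - (zeta s - real K powr (1 - s) / (s - 1))"
  shows "0 \<le> Z" "Z \<le> real K powr (- s)"
proof -
  let ?z = "\<lambda>k. real (Suc k) powr (- s)"
  have "summable ?z"
    using assms(1) by (subst summable_Suc_iff) (simp add: summable_real_powr_iff)
  then have lim: "(\<lambda>N. \<Sum>k<N. ?z k) \<longlonglongrightarrow> zeta s"
    unfolding zeta_def by (rule summable_LIMSEQ)
  have lim0: "(\<lambda>N. real N powr (1 - s)) \<longlonglongrightarrow> 0"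
    using assms(1) by (intro tendsto_neg_powr filterlim_real_sequentially) auto
  have eq: "(\<Sum>k<N. ?z k) = (\<Sum>k=1..N. real k powr (- s))" for N
    by (simp add: sum.atLeast1_atMost_eq)
  have split: "(\<Sum>k<N. ?z k) = (\<Sum>k=1..K. real k powr (- s)) + (\<Sum>k\<in>{K<..N}. real k powr (- s))"
    if "K \<le> N" for N
    unfolding eq using that \<open>K > 0\<close>
    by (subst sum.union_disjoint[symmetric]) (auto intro!: sum.cong)
  have tele: "(\<Sum>k\<in>{K<..N}. real (k - 1) powr (1 - s) - real k powr (1 - s))
                = real K powr (1 - s) - real N powr (1 - s)" if "K \<le> N" for N
    using sum_greaterThanAtMost_telescope[OF that, of "\<lambda>k. - (real k powr (1 - s))"] by simp
  have upper: "(\<Sum>k<N. ?z k) \<le> (\<Sum>k=1..K. real k powr (- s))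
                 + (real K powr (1 - s) - real N powr (1 - s)) / (s - 1)" if "K \<le> N" for N
  proof -
    have "(\<Sum>k\<in>{K<..N}. (s - 1) * real k powr (- s))
            \<le> (\<Sum>k\<in>{K<..N}. real (k - 1) powr (1 - s) - real k powr (1 - s))"
    proof (rule sum_mono)
      fix k assume "k \<in> {K<..N}"
      then show "(s - 1) * real k powr (- s) \<le> real (k - 1) powr (1 - s) - real k powr (1 - s)"
        using powr_minus_increment_bounds(1)[of s "real (k - 1)" "real k"] assms(1,2)
        by (simp add: of_nat_diff)
    qed
    then have "(s - 1) * (\<Sum>k\<in>{K<..N}. real k powr (- s)) \<le> real K powr (1 - s) - real N powr (1 - s)"
      using tele[OF that] by (simp only: sum_distrib_left)
    then show ?thesis
      using assms(1) split[OF that] by (simp add: field_simps)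
  qed
  have lower: "(\<Sum>k<N. ?z k) \<ge> (\<Sum>k=1..K. real k powr (- s)) - real K powr (- s)
                 + (real K powr (1 - s) - real N powr (1 - s)) / (s - 1)" if "K \<le> N" for N
  proof -
    have "(\<Sum>k\<in>{K<..N}. real (k - 1) powr (1 - s) - real k powr (1 - s))
            \<le> (\<Sum>k\<in>{K<..N}. (s - 1) * real (k - 1) powr (- s))"
    proof (rule sum_mono)
      fix k assume "k \<in> {K<..N}"
      then show "real (k - 1) powr (1 - s) - real k powr (1 - s) \<le> (s - 1) * real (k - 1) powr (- s)"
        using powr_minus_increment_bounds(2)[of s "real (k - 1)" "real k"] assms(1,2)
        by (simp add: of_nat_diff)
    qed
    \<comment> \<open>Shifting the index by one changes the sum only at its two ends; the end at
      \<open>K\<close> is the whole error of the lemma.\<close>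
    moreover have "(\<Sum>k\<in>{K<..N}. real (k - 1) powr (- s))
        = (\<Sum>k\<in>{K<..N}. real k powr (- s)) + real K powr (- s) - real N powr (- s)"
      using sum_greaterThanAtMost_telescope[OF that, of "\<lambda>k. - (real k powr (- s))"]
      by (simp add: sum_subtractf)
    ultimately have "real K powr (1 - s) - real N powr (1 - s)
        \<le> (s - 1) * ((\<Sum>k\<in>{K<..N}. real k powr (- s)) + real K powr (- s) - real N powr (- s))"
      using tele[OF that] by (simp only: sum_distrib_left[symmetric])
    also have "\<dots> \<le> (s - 1) * ((\<Sum>k\<in>{K<..N}. real k powr (- s)) + real K powr (- s))"
      using assms(1) by (intro mult_left_mono) auto
    finally show ?thesis
      using assms(1) split[OF that] by (simp add: field_simps)
  qed
  \<comment> \<open>Let \<open>N\<close> tend to infinity in \<open>upper\<close>, and below in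
    \<open>lower\<close>; the terms \<open>N powr (1 - s)\<close> vanish since
    \<open>s > 1\<close>.\<close>
  have "zeta s \<le> (\<Sum>k=1..K. real k powr (- s)) + (real K powr (1 - s) - 0) / (s - 1)"
  proof (rule tendsto_le[OF sequentially_bot _ lim])
    show "\<forall>\<^sub>F N in sequentially. (\<Sum>k<N. ?z k) \<le> (\<Sum>k=1..K. real k powr (- s))
            + (real K powr (1 - s) - real N powr (1 - s)) / (s - 1)"
      by (intro eventually_sequentiallyI[of K] upper)
  qed (use assms(1) in \<open>intro tendsto_intros lim0; simp\<close>)
  then show "0 \<le> Z" by (simp add: Z_def)
  have "zeta s \<ge> (\<Sum>k=1..K. real k powr (- s)) - real K powr (- s)
          + (real K powr (1 - s) - 0) / (s - 1)"
  proof (rule tendsto_le[OF sequentially_bot lim])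
    show "\<forall>\<^sub>F N in sequentially. (\<Sum>k=1..K. real k powr (- s)) - real K powr (- s)
            + (real K powr (1 - s) - real N powr (1 - s)) / (s - 1) \<le> (\<Sum>k<N. ?z k)"
      by (intro eventually_sequentiallyI[of K] lower)
  qed (use assms(1) in \<open>intro tendsto_intros lim0; simp\<close>)
  then show "Z \<le> real K powr (- s)" by (simp add: Z_def)
qed

section \<open>Summation by parts and the hyperbola method\<close>

lemma sum_frac_increments_eq_sum_frac_powr_increments:
  fixes s :: real and n :: nat
  assumes "n > 0"
  shows "(\<Sum>x = 1..n - 1. (frac (real n / real x) - frac (real n / real (x + 1))) * real x powr s)
       = (\<Sum>x\<in>{0<..n}. frac (real n / real x) * (real x powr s - real (x - 1) powr s))"
proof -
  \<comment> \<open>The upper limit \<open>m\<close> is separated from the numerator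
    \<open>n\<close> so that induction is possible. The boundary term disappears at
    \<open>m = n\<close>, where \<open>frac 1 = 0\<close>.\<close>
  have "(\<Sum>x\<in>{0<..m}. frac (real n / real x) * (real x powr s - real (x - 1) powr s))
      = (\<Sum>x = 1..m - 1. (frac (real n / real x) - frac (real n / real (x + 1))) * real x powr s)
        + frac (real n / real m) * real m powr s" if "m > 0" for m
    using that
  proof (induction m rule: nat_induct_non_zero)
    case 1
    have "{0<..Suc 0} = {1}" by auto
    then show ?case by simp
  next
    case (Suc m)
    have "{0<..Suc m} = insert (Suc m) {0<..m}" by auto
    moreover have "{1..Suc m - 1} = insert m {1..m - 1}" "m \<notin> {1..m - 1}"
      using Suc.hyps by auto
    ultimately show ?case using Suc.IH by (simp add: algebra_simps)
  qed
  from this[OF assms] show ?thesis using assms by simp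
qed

text \<open>Dirichlet's hyperbola method: \<open>n div x\<close> counts the \<open>k\<close> with \<open>x \<le> n div k\<close>, and these satisfy
  \<open>k < K\<close> once \<open>x > n div K\<close>.\<close>

lemma sum_div_increments_eq:
  fixes f :: "nat \<Rightarrow> real" and n K :: nat
  assumes "K > 0"
  shows "(\<Sum>x\<in>{n div K<..n}. real (n div x) * (f x - f (x - 1)))
       = (\<Sum>k=1..K. f (n div k) - f (n div K))"
proof -
  have "(\<Sum>k=1..K. f (n div k) - f (n div K))
      = (\<Sum>k=1..K. \<Sum>x\<in>{n div K<..n}. if x \<le> n div k then f x - f (x - 1) else 0)"
  proof (rule sum.cong[OF refl])
    fix k assume k: "k \<in> {1..K}"
    then have "n div K \<le> n div k" by (intro div_le_mono2) auto
    then have "f (n div k) - f (n div K) = (\<Sum>x\<in>{n div K<..n div k}. f x - f (x - 1))"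
      by (rule sum_greaterThanAtMost_telescope[symmetric])
    also have "{n div K<..n div k} = {x \<in> {n div K<..n}. x \<le> n div k}"
      by (auto intro: order_trans[OF _ div_le_dividend])
    finally show "f (n div k) - f (n div K)
        = (\<Sum>x\<in>{n div K<..n}. if x \<le> n div k then f x - f (x - 1) else 0)"
      by (simp only: sum.inter_filter[OF finite_greaterThanAtMost])
  qed
  also have "\<dots> = (\<Sum>x\<in>{n div K<..n}. \<Sum>k=1..K. if x \<le> n div k then f x - f (x - 1) else 0)"
    by (rule sum.swap)
  also have "\<dots> = (\<Sum>x\<in>{n div K<..n}. real (n div x) * (f x - f (x - 1)))"
  proof (rule sum.cong[OF refl])
    fix x assume x: "x \<in> {n div K<..n}"
    then have "x > 0" by simp
    with x have "n div x < K"
      using assms by (simp add: div_less_iff_less_mult mult.commute)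
    moreover have "x \<le> n div k \<longleftrightarrow> k \<le> n div x" if "k \<ge> 1" for k
      using that x by (simp add: less_eq_div_iff_mult_less_eq mult.commute)
    ultimately have "{k \<in> {1..K}. x \<le> n div k} = {1..n div x}"
      by auto
    then show "(\<Sum>k=1..K. if x \<le> n div k then f x - f (x - 1) else 0)
        = real (n div x) * (f x - f (x - 1))"
      by (simp add: sum.inter_filter[symmetric])
  qed
  finally show ?thesis ..
qed

section \<open>Errors of replacing a sum by an integral and of rounding \<open>n / k\<close>\<close>

lemma sum_powr_increments_over_arg_bounds:
  fixes s :: real and X n :: nat
  assumes "s > 1" "0 < X" "X \<le> n"
  defines "E \<equiv> s / (s - 1) * (real n powr (s - 1) - real X powr (s - 1))
                - (\<Sum>x\<in>{X<..n}. (real x powr s - real (x - 1) powr s) / real x)"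
  shows "0 \<le> E" "E \<le> s * real n powr (s - 1) / real X"
proof -
  define c where "c = s / (s - 1)"
  define e where "e x = c * (real x powr (s - 1) - real (x - 1) powr (s - 1))
                    - (real x powr s - real (x - 1) powr s) / real x" for x
  have E: "E = (\<Sum>x\<in>{X<..n}. e x)"
    using sum_greaterThanAtMost_telescope[OF assms(3), of "\<lambda>x. real x powr (s - 1)"]
    unfolding E_def e_def sum_subtractf sum_distrib_left[symmetric] c_def[symmetric] by simp
  \<comment> \<open>The quotient bounds put \<open>e x\<close> between 0 and
    \<open>w * (1 / b - 1 / a)\<close>. Bounding \<open>w\<close> uniformly in \<open>x\<close>
    leaves a telescoping sum of reciprocals, whence the \<open>1 / X\<close>.\<close>
  have bounds: "0 \<le> e x" "e x \<le> s * real n powr (s - 1) * (1 / real (x - 1) - 1 / real x)"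
    if "x \<in> {X<..n}" for x
  proof -
    define a b where "a = real x" and "b = real (x - 1)"
    have ab: "0 < b" "b < a" "a - b = 1" "a \<le> real n"
      using that assms by (auto simp: a_def b_def of_nat_diff)
    define w where "w = a powr s - b powr s"
    note q = powr_increment_quotient_bounds[OF assms(1) ab(1,2), folded c_def w_def]
    show "0 \<le> e x"
      using q(1) by (simp add: e_def a_def b_def w_def)
    have "w \<le> s * a powr (s - 1)"
      using powr_diff_le[of s b a] ab assms(1) by (simp add: w_def)
    also have "\<dots> \<le> s * real n powr (s - 1)"
      using ab assms(1) by (intro mult_left_mono powr_mono2) auto
    finally have w: "w \<le> s * real n powr (s - 1)" .
    have "e x \<le> w / b - w / a"
      using q(2) by (simp add: e_def a_def b_def w_def)
    also have "\<dots> = w * (1 / b - 1 / a)"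
      by (simp add: algebra_simps)
    also have "\<dots> \<le> s * real n powr (s - 1) * (1 / b - 1 / a)"
      using w ab by (intro mult_right_mono) (auto simp: frac_le)
    finally show "e x \<le> s * real n powr (s - 1) * (1 / real (x - 1) - 1 / real x)"
      by (simp add: a_def b_def)
  qed
  show "0 \<le> E"
    unfolding E by (intro sum_nonneg bounds)
  have "E \<le> s * real n powr (s - 1) * (\<Sum>x\<in>{X<..n}. 1 / real (x - 1) - 1 / real x)"
    unfolding E sum_distrib_left by (intro sum_mono bounds)
  also have "(\<Sum>x\<in>{X<..n}. 1 / real (x - 1) - 1 / real x) = 1 / real X - 1 / real n"
    using sum_greaterThanAtMost_telescope[OF assms(3), of "\<lambda>x. - (1 / real x)"] by simp
  also have "s * real n powr (s - 1) * (1 / real X - 1 / real n) \<le> s * real n powr (s - 1) * (1 / real X)"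
    using assms(1) by (intro mult_left_mono) auto
  finally show "E \<le> s * real n powr (s - 1) / real X" by simp
qed

text \<open>Rounding \<open>n / k\<close> down costs at most 1, hence at most \<open>1 / n\<close>
  after scaling by \<open>n\<close>; \<open>powr_diff_le\<close> carries this over to the powers.
  The condition \<open>k \<le> n\<close> keeps the rounded value positive.\<close>

lemma powr_div_nat_bounds:
  fixes s :: real and k n :: nat
  assumes "s > 1" "0 < k" "k \<le> n"
  defines "d \<equiv> (1 / real k) powr s - (real (n div k) / real n) powr s"
  shows "0 \<le> d" "d \<le> s / real n"
proof -
  define a b where "a = 1 / real k" and "b = real (n div k) / real n"
  have n: "n > 0" using assms by simp
  have "real (n div k) \<le> real n / real k"
    by (rule of_nat_div_le_of_nat)
  then have ba: "b \<le> a"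
    using n assms by (simp add: a_def b_def field_simps)
  have "n div k > 0" using assms by (simp add: div_greater_zero_iff)
  then have b: "0 < b" using n by (simp add: b_def)
  have "real n / real k \<le> real (n div k) + 1"
    using real_of_int_floor_add_one_ge[of "real n / real k"] by (simp add: floor_divide_of_nat_eq)
  then have "(real n / real k) / real n \<le> (real (n div k) + 1) / real n"
    by (intro divide_right_mono) auto
  then have ab: "a - b \<le> 1 / real n"
    using n by (simp add: a_def b_def add_divide_distrib)
  show "0 \<le> d"
    using ba b assms(1) by (simp add: d_def a_def[symmetric] b_def[symmetric] powr_mono2)
  have "d \<le> s * (a - b) * a powr (s - 1)"
    using powr_diff_le[of s b a] ba b assms(1) by (simp add: d_def a_def b_def)
  also have "\<dots> \<le> s * (1 / real n) * a powr (s - 1)"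
    using ab assms(1) by (intro mult_right_mono mult_left_mono) auto
  also have "a powr (s - 1) = real k powr (1 - s)"
    by (simp add: a_def powr_divide powr_minus_divide[symmetric])
  finally have *: "d \<le> s / real n * real k powr (1 - s)" by simp
  \<comment> \<open>The decay in \<open>k\<close> can be given up: \<open>K\<close> such errors add
    up to \<open>s * K / n\<close>, which has the desired order for \<open>K\<close> near
    \<open>sqrt n\<close>.\<close>
  have "real k powr (1 - s) \<le> real k powr 0"
    using assms by (intro powr_mono) auto
  then have "s / real n * real k powr (1 - s) \<le> s / real n * 1"
    using assms by (intro mult_left_mono) auto
  with * show "d \<le> s / real n" by simp
qed

section \<open>Assembly of the error terms for a free parameter \<open>K\<close>\<close>

lemma sum_frac_increments_minus_limit_bound:
  fixes s :: real and K n :: nat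
  assumes "s > 1" "0 < K" "K \<le> n"
  shows "\<bar>1 / real n powr s *
            (\<Sum>x = 1..n - 1. (frac (real n / real x) - frac (real n / real (x + 1))) * real x powr s)
          - (1 / (s - 1) + 1 - zeta s)\<bar>
         \<le> 2 * real K powr (- s) + s / real (n div K) + (2 + s / (s - 1)) * (s * real K / real n)"
proof -
  define X where "X = n div K"
  define N where "N = real n powr s"
  define c where "c = s / (s - 1)"
  define w where "w x = real x powr s - real (x - 1) powr s" for x
  define P where "P = real K powr (1 - s)"
  have n: "n > 0" using assms by simp
  have N: "N > 0" using n by (simp add: N_def)
  have X: "0 < X" "X \<le> n"
    using assms by (auto simp: X_def div_greater_zero_iff)
  have w: "w x \<ge> 0" for x
    using assms(1) by (auto simp: w_def intro!: powr_mono2)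
  have scale: "real m powr s / N = (real m / real n) powr s" for m
    by (simp add: N_def powr_divide)
  define A where "A = (\<Sum>x\<in>{0<..X}. frac (real n / real x) * w x) / N"
  define V where "V = (\<Sum>x\<in>{X<..n}. w x / real x)"
  define Q where "Q = (\<Sum>k=1..K. (real (n div k) / real n) powr s)"

  have "1 / N * (\<Sum>x = 1..n - 1. (frac (real n / real x) - frac (real n / real (x + 1))) * real x powr s)
      = (\<Sum>x\<in>{0<..n}. frac (real n / real x) * w x) / N"
    by (simp only: sum_frac_increments_eq_sum_frac_powr_increments[OF n] w_def) simp
  also have "{0<..n} = {0<..X} \<union> {X<..n}"
    using X by auto
  also have "(\<Sum>x\<in>\<dots>. frac (real n / real x) * w x)
      = (\<Sum>x\<in>{0<..X}. frac (real n / real x) * w x) + (\<Sum>x\<in>{X<..n}. frac (real n / real x) * w x)"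
    by (rule sum.union_disjoint) auto
  also have "(\<Sum>x\<in>{X<..n}. frac (real n / real x) * w x)
      = real n * V - (\<Sum>x\<in>{X<..n}. real (n div x) * w x)"
    by (simp add: V_def frac_def floor_divide_of_nat_eq left_diff_distrib sum_subtractf
          sum_distrib_left)
  also have "(\<Sum>x\<in>{X<..n}. real (n div x) * w x) = (\<Sum>k=1..K. real (n div k) powr s - real X powr s)"
    unfolding w_def X_def
    by (rule sum_div_increments_eq[OF assms(2), of n "\<lambda>x. real x powr s"])
  also have "\<dots> = N * Q - real K * real X powr s"
    using N by (simp add: sum_subtractf Q_def sum_distrib_left scale[symmetric])
  finally have main: "1 / N *
        (\<Sum>x = 1..n - 1. (frac (real n / real x) - frac (real n / real (x + 1))) * real x powr s)
      = A + real n * V / N - Q + real K * (real X / real n) powr s"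
    using N by (simp add: A_def scale[symmetric] field_simps)

  note dK = powr_div_nat_bounds[OF assms, folded X_def]
  have K_powr: "(1 / real K) powr s = real K powr (- s)"
    by (simp add: powr_divide powr_minus_divide)
  have P: "real K * real K powr (- s) = P"
    using assms(2) by (simp add: P_def powr_diff powr_minus_divide)

  have A0: "0 \<le> A"
    using N w by (auto simp: A_def intro!: divide_nonneg_pos sum_nonneg mult_nonneg_nonneg)
  \<comment> \<open>For small \<open>x\<close> the trivial bound on fractional parts suffices: the
    increments telescope to \<open>X powr s\<close>, and \<open>X / n\<close> is at most
    \<open>1 / K\<close>.\<close>
  have "(\<Sum>x\<in>{0<..X}. frac (real n / real x) * w x) \<le> (\<Sum>x\<in>{0<..X}. 1 * w x)"
    by (intro sum_mono mult_right_mono w less_imp_le frac_lt_1)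
  also have "\<dots> = real X powr s"
    using sum_greaterThanAtMost_telescope[of 0 X "\<lambda>x. real x powr s"] by (simp add: w_def)
  finally have "A \<le> (real X / real n) powr s"
    unfolding A_def scale[symmetric] using N by (intro divide_right_mono) auto
  with dK(1) have A1: "A \<le> real K powr (- s)"
    by (simp add: K_powr)

  \<comment> \<open>\<open>E1\<close> is the integral error, \<open>E2\<close> the rounding error in
    the hyperbola sum, \<open>E3\<close> the zeta tail error. \<open>E4\<close> and
    \<open>E5\<close> compare the two remaining powers of \<open>X / n\<close> with the common
    quantity \<open>P\<close>, the value both take when \<open>X / n\<close> is replaced by
    \<open>1 / K\<close>.\<close>
  define E1 where "E1 = c * (1 - (real X / real n) powr (s - 1)) - real n * V / N"
  note eV = sum_powr_increments_over_arg_bounds[OF assms(1) X, folded c_def w_def V_def]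
  have N': "N = real n * real n powr (s - 1)"
    using n by (simp add: N_def powr_diff)
  have "E1 = (c * (real n powr (s - 1) - real X powr (s - 1)) - V) / real n powr (s - 1)"
    using n by (simp add: E1_def N' powr_divide field_simps)
  with eV(1) divide_right_mono[OF eV(2), of "real n powr (s - 1)"] n
  have E1: "0 \<le> E1" "E1 \<le> s / real X"
    by simp_all

  define E2 where "E2 = (\<Sum>k=1..K. real k powr (- s)) - Q"
  have E2_eq: "E2 = (\<Sum>k=1..K. (1 / real k) powr s - (real (n div k) / real n) powr s)"
    unfolding E2_def Q_def sum_subtractf by (simp add: powr_divide powr_minus_divide)
  have E2: "0 \<le> E2" "E2 \<le> s * real K / real n"
  proof -
    show "0 \<le> E2" unfolding E2_eq
      using assms by (intro sum_nonneg powr_div_nat_bounds(1)) auto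
    have "E2 \<le> (\<Sum>k=1..K. s / real n)" unfolding E2_eq
      using assms by (intro sum_mono powr_div_nat_bounds(2)) auto
    then show "E2 \<le> s * real K / real n" by (simp add: mult.commute)
  qed

  define E3 where "E3 = (\<Sum>k=1..K. real k powr (- s)) - (zeta s - P / (s - 1))"
  note E3 = zeta_partial_sum_bounds[OF assms(1,2), folded P_def, folded E3_def]

  define E4 where "E4 = P - real K * (real X / real n) powr s"
  have E4_eq: "E4 = real K * ((1 / real K) powr s - (real X / real n) powr s)"
    by (simp add: E4_def right_diff_distrib K_powr P)
  have E4: "0 \<le> E4" "E4 \<le> s * real K / real n"
    using dK(1) mult_left_mono[OF dK(2), of "real K"] by (simp_all add: E4_eq mult.commute)

  define E5 where "E5 = P - (real X / real n) powr (s - 1)"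
  have XK: "real X / real n \<le> 1 / real K"
    using of_nat_div_le_of_nat[of n K, where 'a = real] n assms(2) by (simp add: X_def field_simps)
  have E5: "0 \<le> E5" "E5 \<le> E4"
  proof -
    have "(real X / real n) powr (s - 1) \<le> (1 / real K) powr (s - 1)"
      using XK assms(1) by (intro powr_mono2) auto
    also have "\<dots> = P"
      by (simp add: P_def powr_divide powr_minus_divide[symmetric])
    finally show "0 \<le> E5" by (simp add: E5_def)
    \<comment> \<open>The exponent \<open>s - 1\<close> may lie below 1, outside the range of
      \<open>powr_diff_le\<close>. Instead one factor \<open>X / n\<close> is split off from the
      power in \<open>E4\<close> and absorbed by \<open>K\<close>.\<close>
    have "real K * (real X / real n) \<le> 1"
      using XK assms(2) by (simp add: field_simps)
    then have "real K * (real X / real n) * (real X / real n) powr (s - 1)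
        \<le> 1 * (real X / real n) powr (s - 1)"
      by (rule mult_right_mono) simp
    moreover have "(real X / real n) powr s = (real X / real n) * (real X / real n) powr (s - 1)"
      using X n by (simp add: powr_diff)
    ultimately show "E5 \<le> E4" by (simp add: E4_def E5_def)
  qed

  have c: "c = 1 + 1 / (s - 1)" "c \<ge> 0"
    using assms(1) by (auto simp: c_def field_simps)
  \<comment> \<open>Here \<open>P\<close> cancels: it enters with coefficient \<open>- c\<close>
    from the integral, \<open>1 / (s - 1)\<close> from the zeta tail and 1 from the boundary term of
    the hyperbola sum.\<close>
  have eq: "A + real n * V / N - Q + real K * (real X / real n) powr s - (1 / (s - 1) + 1 - zeta s)
      = A - E1 + E2 - E3 - E4 + c * E5"
    unfolding E1_def E2_def E3_def E4_def E5_def c(1) by (simp add: algebra_simps)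
  define u where "u = s * real K / real n"
  have "0 \<le> c * E5" "c * E5 \<le> c * u"
    unfolding u_def using c(2) order_trans[OF E5(2) E4(2)] E5(1)
    by (intro mult_nonneg_nonneg mult_left_mono; simp)+
  \<comment> \<open>All errors are nonnegative, so signs are harmless. \<open>A\<close> and
    \<open>E3\<close> each give \<open>K powr (- s)\<close>, while \<open>E2\<close> and
    \<open>E4\<close> each give \<open>u\<close>.\<close>
  with A0 A1 E1 E2 E3 E4
  have "\<bar>A - E1 + E2 - E3 - E4 + c * E5\<bar> \<le> 2 * real K powr (- s) + s / real X + (2 * u + c * u)"
    unfolding u_def[symmetric] abs_le_iff by linarith
  then show ?thesis
    unfolding N_def[symmetric] main X_def[symmetric] c_def[symmetric] eq u_def[symmetric]
    by (simp only: distrib_right)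
qed

theorem theorem3:
  fixes s :: real
  assumes "s > 1"
  shows "(\<lambda>n::nat. 1 / real n powr s *
            (\<Sum>x = 1..n - 1. (frac (real n / real x) - frac (real n / real (x + 1))) * real x powr s)
          - (1 / (s - 1) + 1 - zeta s))
         \<in> O[at_top](\<lambda>n. 1 / sqrt (real n))"
proof (rule bigoI, rule eventually_mono[OF eventually_ge_at_top[of "4 :: nat"]])
  fix n :: nat
  assume n: "n \<ge> 4"
  define r where "r = sqrt (real n)"
  \<comment> \<open>This choice balances \<open>s / X\<close>, of order \<open>K / n\<close>,
    against \<open>K powr (- s)\<close>, which is at most \<open>1 / K\<close>.\<close>
  define K where "K = nat \<lfloor>r\<rfloor>"
  define X where "X = n div K"
  \<comment> \<open>The threshold 4 gives \<open>r - 1 \<ge> r / 2\<close>; both \<open>K\<close>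
    and \<open>X\<close> are at least \<open>r - 1\<close>.\<close>
  have r: "r \<ge> 2" "r * r = real n"
    using n real_sqrt_le_mono[of 4 "real n"] by (auto simp: r_def)
  have K: "real K \<le> r" "r < real K + 1"
    using r by (auto simp: K_def)
  have K2: "r / 2 \<le> real K" using K r by linarith
  have K0: "K > 0" using K r by (cases K) auto
  have "r * 1 \<le> r * r" using r by (intro mult_left_mono) auto
  then have Kn: "K \<le> n" using K r by (intro of_nat_le_iff[where 'a = real, THEN iffD1]) linarith
  have "real n / real K \<le> real X + 1"
    using real_of_int_floor_add_one_ge[of "real n / real K"]
    by (simp add: floor_divide_of_nat_eq X_def)
  moreover have "r \<le> real n / real K"
    using K K0 r by (simp add: field_simps flip: r(2))
  ultimately have X2: "r / 2 \<le> real X" using r by linarith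
  have "real K powr (- s) \<le> real K powr (- 1)"
    using K0 assms by (intro powr_mono) auto
  also have "\<dots> = 1 / real K"
    using K0 by (simp add: powr_minus_divide)
  also have "\<dots> \<le> 1 / (r / 2)"
    using K2 r by (intro divide_left_mono) auto
  finally have B1: "2 * real K powr (- s) \<le> 4 * (1 / r)" by simp
  have "s / real X \<le> s / (r / 2)"
    using X2 r assms by (intro divide_left_mono) auto
  then have B2: "s / real X \<le> 2 * s * (1 / r)" by (simp add: mult.commute)
  have "s * real K / real n \<le> s * r / real n"
    using K assms by (intro divide_right_mono mult_left_mono) auto
  also have "\<dots> = s * (1 / r)"
    using r by (simp flip: r(2))
  finally have B3: "(2 + s / (s - 1)) * (s * real K / real n) \<le> (2 + s / (s - 1)) * (s * (1 / r))"
    using assms by (intro mult_left_mono) auto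
  have "4 * (1 / r) + 2 * s * (1 / r) + (2 + s / (s - 1)) * (s * (1 / r))
      = (4 + 2 * s + (2 + s / (s - 1)) * s) * (1 / r)"
    by (simp only: distrib_right mult.assoc)
  with B1 B2 B3 sum_frac_increments_minus_limit_bound[OF assms K0 Kn, folded X_def]
  show "norm (1 / real n powr s *
            (\<Sum>x = 1..n - 1. (frac (real n / real x) - frac (real n / real (x + 1))) * real x powr s)
          - (1 / (s - 1) + 1 - zeta s))
         \<le> (4 + 2 * s + (2 + s / (s - 1)) * s) * norm (1 / sqrt (real n))"
    using r by (simp only: real_norm_def r_def[symmetric] abs_of_nonneg[of "1 / r"]) simp
qed

end
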